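(* Let $q,a,b,z$ be complex numbers with $|q|<1$, $|b/a|<|z|<1$ and $|a|<1$. Then \[ \sum_{n=-\infty}^{\infty}\frac{(a)_n}{(b)_n}z^n = -1 +\frac{(a)_\infty(qz)_\infty}{(b)_\infty(z)_\infty}\sum_{n=0}^{\infty}\frac{(b/a)_n(z)_n}{(q)_n(qz)_n}a^n +\frac{(b/a)_\infty(q/az)_\infty}{(q/a)_\infty(b/az)_\infty}\sum_{n=0}^{\infty}\frac{(q/z)_n(q/b)_n}{(q)_n(q/az)_n}(b/a)^n . \]
   Context: For $|q|<1$ and complex $x$, $(x)_\infty=(x;q)_\infty=\prod_{k=0}^{\infty}(1-xq^k)$, and for any integer $n$ (positive, zero or negative), $(x)_n=(x)_\infty/(xq^n)_\infty$. *)

theory Defs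
  imports "HOL-Analysis.Analysis"
begin

definition qpoch_inf :: "complex \<Rightarrow> complex \<Rightarrow> complex" where
  "qpoch_inf q x = (\<Prod>k. 1 - x * q ^ k)"

text \<open>
  The first branch is the quotient $(x)_\infty/(xq^n)_\infty$. The other two only apply when its
  denominator vanishes; they give the value of the quotient after cancelling the common factors.
  (For instance $(q^{-1})_1 = 1 - q^{-1}$, although the quotient reads $0/0$.)
  If $n < 0$ and $x = q^k$ with $1 \le k \le -n$, then $(x)_n$ is a genuine pole, and the
  totalised division returns $0$. A term having such an $(x)_n$ as its denominator is then $0$,
  in accordance with $1/(x)_n = (xq^n)_\infty/(x)_\infty = 0$.
\<close>
definition qpoch :: "complex \<Rightarrow> complex \<Rightarrow> int \<Rightarrow> complex" where
  "qpoch q x n =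
    (if qpoch_inf q (x * q powi n) \<noteq> 0 then qpoch_inf q x / qpoch_inf q (x * q powi n)
     else if n \<ge> 0 then (\<Prod>k<nat n. 1 - x * q ^ k)
     else 1 / (\<Prod>k=1..nat (-n). 1 - x / q ^ k))"

lemma convergent_prod_qpoch_inf:
  assumes "norm q < 1"
  shows "convergent_prod (\<lambda>k. 1 - x * q ^ k :: complex)"
proof -
  have "summable (\<lambda>k. norm ((1 - x * q ^ k) - 1))"
    using assms by (simp add: norm_mult norm_power summable_mult summable_geometric)
  then show ?thesis
    by (intro abs_convergent_prod_imp_convergent_prod summable_imp_abs_convergent_prod)
qed

lemma qpoch_inf_split:
  assumes "norm q < 1"
  shows "qpoch_inf q x = (\<Prod>k<n. 1 - x * q ^ k) * qpoch_inf q (x * q ^ n)"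
proof (induction n)
  case (Suc n)
  have "qpoch_inf q y = (1 - y) * qpoch_inf q (y * q)" for y
  proof -
    from has_prod_ignore_initial_segment'[OF convergent_prod_qpoch_inf[OF assms], of y 1]
    have *: "(\<lambda>k. 1 - y * q ^ k) has_prod ((1 - y) * (\<Prod>k. 1 - y * q ^ Suc k))"
      by simp
    have "(\<Prod>k. 1 - y * q ^ Suc k) = qpoch_inf q (y * q)"
      unfolding qpoch_inf_def by (simp add: mult.assoc)
    with * show ?thesis
      unfolding qpoch_inf_def using has_prod_unique2 has_prod_iff by metis
  qed
  from this[of "x * q ^ n"] Suc show ?case
    by (simp add: mult_ac)
qed simp

lemma qpoch_nonneg:
  assumes "norm q < 1"
  shows "qpoch q x (int n) = (\<Prod>k<n. 1 - x * q ^ k)"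
  using qpoch_inf_split[OF assms, of x n] by (simp add: qpoch_def)

lemma qpoch_neg:
  assumes "norm q < 1" "q \<noteq> 0"
  shows "qpoch q x (- int n) = 1 / (\<Prod>k=1..n. 1 - x / q ^ k)"
proof (cases "n = 0")
  case True
  then show ?thesis
    using qpoch_nonneg[OF assms(1), of x 0] by simp
next
  case False
  let ?y = "x / q ^ n"
  have "(\<Prod>k<n. 1 - ?y * q ^ k) = (\<Prod>k=1..n. 1 - x / q ^ k)"
    by (rule prod.reindex_bij_witness[of _ "\<lambda>k. n - k" "\<lambda>k. n - k"])
       (use assms in \<open>auto simp: power_diff field_simps\<close>)
  with qpoch_inf_split[OF assms(1), of ?y n] assms(2)
  have *: "qpoch_inf q ?y = (\<Prod>k=1..n. 1 - x / q ^ k) * qpoch_inf q x"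
    by simp
  have "x * q powi (- int n) = ?y"
    by (simp add: power_int_minus field_simps)
  with * False show ?thesis
    by (auto simp: qpoch_def)
qed

end

theory Submission
  imports Defs "HOL-Complex_Analysis.Complex_Analysis"
begin

text \<open>
  Split at \<open>n = 0\<close>, the bilateral series is a sum of two series \<open>\<^sub>2\<phi>\<^sub>1\<close> with first parameter \<open>q\<close>,
  one with argument \<open>z\<close> and one with argument \<open>b/(az)\<close>, and each of them is subjected to one of
  Heine's transformations. Expanding \<open>(dbq\<^sup>n)\<^sub>\<infinity>/(bq\<^sup>n)\<^sub>\<infinity>\<close> by the \<open>q\<close>-binomial theorem gives
  \<open>(db)\<^sub>\<infinity>/(b)\<^sub>\<infinity> \<^sub>2\<phi>\<^sub>1(a, b; db; z) = \<Sum>\<^sub>n \<Sum>\<^sub>k (a)\<^sub>n/(q)\<^sub>n (d)\<^sub>k/(q)\<^sub>k z\<^sup>n b\<^sup>k q\<^sup>n\<^sup>k\<close>,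
  and the double series is invariant under exchanging \<open>(a, z)\<close> with \<open>(d, b)\<close>: this is Heine's first
  transformation, valid for \<open>|b| < 1\<close>. Applied twice it yields the second one, in which \<open>b\<close> is no
  longer an argument of a series, so that \<open>|b| < 1\<close> can be removed by analytic continuation. This
  matters because the second series of the theorem has \<open>q/b\<close> in the place of \<open>b\<close>.
\<close>

subsection \<open>Absolutely convergent series\<close>

lemma summable_norm_Bseq_times_power:
  fixes c :: "nat \<Rightarrow> 'a :: real_normed_div_algebra"
  assumes "Bseq c" "norm x < 1"
  shows "summable (\<lambda>n. norm (c n * x ^ n))"
proof -
  obtain K where K: "\<And>n. norm (c n) \<le> K"
    using assms(1) by (metis BseqE)
  show ?thesis
    by (rule summable_comparison_test'[where g = "\<lambda>n. K * norm x ^ n"])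
       (use assms(2) K in \<open>auto simp: norm_mult norm_power intro: mult_right_mono\<close>)
qed

lemma summable_on_Times_dominated:
  fixes f :: "nat \<Rightarrow> nat \<Rightarrow> 'a :: banach"
  assumes u: "summable u" "\<And>n. 0 \<le> u n" and v: "summable v" "\<And>k. 0 \<le> v k"
    and bound: "\<And>n k. norm (f n k) \<le> u n * v k"
  shows "(\<lambda>(n, k). f n k) summable_on (UNIV \<times> UNIV)"
proof -
  have "(\<lambda>(n, k). u n * v k) summable_on (UNIV \<times> UNIV)"
  proof (rule summable_on_SigmaI)
    have "(v has_sum suminf v) UNIV"
      using v by (intro norm_summable_imp_has_sum summable_sums) auto
    then show "((\<lambda>k. case (n, k) of (n, k) \<Rightarrow> u n * v k) has_sum u n * suminf v) UNIV" for n
      by (simp add: has_sum_cmult_right)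
    have "u summable_on UNIV"
      using u by (intro norm_summable_imp_summable_on) auto
    then show "(\<lambda>n. u n * suminf v) summable_on UNIV"
      by (rule summable_on_cmult_left)
  qed (use u v in auto)
  then have "(\<lambda>x. norm (case x of (n, k) \<Rightarrow> f n k)) summable_on (UNIV \<times> UNIV)"
    by (rule Infinite_Sum.abs_summable_on_comparison_test') (use bound in auto)
  then show ?thesis
    by (rule abs_summable_summable)
qed

lemma has_sum_suminf_dominated:
  fixes f :: "nat \<Rightarrow> 'a :: banach"
  assumes "summable g" "\<And>n. norm (f n) \<le> g n"
  shows "(f has_sum suminf f) UNIV"
proof (rule norm_summable_imp_has_sum)
  show "summable (\<lambda>n. norm (f n))"
    using assms(1) by (rule summable_comparison_test') (simp add: assms(2))
  then show "f sums suminf f"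
    by (rule summable_sums[OF summable_norm_cancel])
qed

lemma suminf_swap_dominated:
  fixes f :: "nat \<Rightarrow> nat \<Rightarrow> 'a :: banach"
  assumes u: "summable u" "\<And>n. 0 \<le> u n" and v: "summable v" "\<And>k. 0 \<le> v k"
    and bound: "\<And>n k. norm (f n k) \<le> u n * v k"
  shows "(\<Sum>n. \<Sum>k. f n k) = (\<Sum>k. \<Sum>n. f n k)"
proof -
  obtain S where S: "((\<lambda>(n, k). f n k) has_sum S) (UNIV \<times> UNIV)"
    using summable_on_Times_dominated[OF assms] by (auto simp: summable_on_def)
  have row_sum: "(f n has_sum (\<Sum>k. f n k)) UNIV" for n
    by (rule has_sum_suminf_dominated[OF summable_mult[OF v(1)] bound])
  have column_sum: "((\<lambda>n. f n k) has_sum (\<Sum>n. f n k)) UNIV" for k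
    by (rule has_sum_suminf_dominated[OF summable_mult2[OF u(1)] bound])
  have "((\<lambda>n. \<Sum>k. f n k) has_sum S) UNIV"
    by (rule has_sum_SigmaD[OF S]) (use row_sum in simp)
  moreover have "((\<lambda>(k, n). f n k) has_sum S) (UNIV \<times> UNIV)"
    using S by (subst has_sum_swap) (simp add: case_prod_beta)
  then have "((\<lambda>k. \<Sum>n. f n k) has_sum S) UNIV"
    by (rule has_sum_SigmaD) (use column_sum in simp)
  ultimately show ?thesis
    by (auto dest!: has_sum_imp_sums simp: sums_iff)
qed

lemma has_sum_int_halves:
  fixes f :: "int \<Rightarrow> 'a :: banach"
  assumes "summable (\<lambda>n. norm (f (int n)))" "summable (\<lambda>n. norm (f (- int n)))"
  shows "(f has_sum ((\<Sum>n. f (int n)) + (\<Sum>n. f (- int n)) - f 0)) UNIV"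
proof -
  define S where "S = (\<Sum>n. f (int n))"
  define T where "T = (\<Sum>n. f (- int n))"
  have "((\<lambda>n. f (int n)) has_sum S) UNIV"
    unfolding S_def by (intro norm_summable_imp_has_sum summable_sums[OF summable_norm_cancel] assms)
  then have nonneg: "(f has_sum S) (range int)"
    by (subst has_sum_reindex) (auto simp: o_def)
  have "((\<lambda>n. f (- int (Suc n))) has_sum (T - f 0)) UNIV"
  proof (rule norm_summable_imp_has_sum)
    show "summable (\<lambda>n. norm (f (- int (Suc n))))"
      using assms(2) by (subst summable_Suc_iff)
    have "(\<lambda>n. f (- int n)) sums T"
      unfolding T_def by (intro summable_sums[OF summable_norm_cancel] assms)
    then show "(\<lambda>n. f (- int (Suc n))) sums (T - f 0)"
      by (subst sums_Suc_iff) simp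
  qed
  then have neg: "(f has_sum (T - f 0)) (range (\<lambda>n. - int (Suc n)))"
    by (subst has_sum_reindex) (auto simp: o_def inj_def)
  have "UNIV = range int \<union> range (\<lambda>n. - int (Suc n))"
  proof (rule UNIV_eq_I)
    show "x \<in> range int \<union> range (\<lambda>n. - int (Suc n))" for x
      by (cases x rule: int_cases) blast+
  qed
  moreover have "range int \<inter> range (\<lambda>n. - int (Suc n)) = {}"
    by auto
  ultimately have "(f has_sum (S + (T - f 0))) UNIV"
    using has_sum_Un_disjoint[OF nonneg neg] by simp
  then show ?thesis
    by (simp add: S_def T_def add_diff_eq)
qed

subsection \<open>Finite \<open>q\<close>-Pochhammer symbols\<close>

definition qpoch_fin :: "'a :: comm_ring_1 \<Rightarrow> 'a \<Rightarrow> nat \<Rightarrow> 'a" where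
  "qpoch_fin q x n = (\<Prod>k<n. 1 - x * q ^ k)"

lemma qpoch_fin_0 [simp]: "qpoch_fin q x 0 = 1"
  by (simp add: qpoch_fin_def)

lemma qpoch_fin_Suc: "qpoch_fin q x (Suc n) = qpoch_fin q x n * (1 - x * q ^ n)"
  by (simp add: qpoch_fin_def)

lemma qpoch_fin_nonzero:
  fixes q x :: "'a :: idom"
  assumes "\<And>k. x * q ^ k \<noteq> 1"
  shows "qpoch_fin q x n \<noteq> 0"
  using assms by (auto simp: qpoch_fin_def)

lemma prod_one_minus_divide_power:
  fixes q x :: "'a :: field"
  assumes "q \<noteq> 0" "x \<noteq> 0"
  shows "(\<Prod>k=1..n. 1 - x / q ^ k) = qpoch_fin q (q / x) n * (\<Prod>k=1..n. - x / q ^ k)"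
proof (induction n)
  case (Suc n)
  have "1 - x / q ^ Suc n = (1 - q / x * q ^ n) * (- x / q ^ Suc n)"
    using assms by (simp add: field_simps)
  with Suc show ?case
    by (simp add: qpoch_fin_Suc prod.nat_ivl_Suc' mult_ac)
qed simp

lemma q_divide_mult_power_neq_1:
  fixes q x :: "'a :: field"
  assumes "x \<noteq> 0" "\<forall>k\<ge>1. x \<noteq> q ^ k"
  shows "q / x * q ^ k \<noteq> 1"
  using assms(1) assms(2)[rule_format, of "Suc k"] by (auto simp: field_simps)

lemma norm_mult_power_le:
  fixes q x :: "'a :: real_normed_div_algebra"
  assumes "norm q < 1"
  shows "norm (x * q ^ k) \<le> norm x"
  unfolding norm_mult norm_power using assms by (intro mult_left_le power_le_one) auto

lemma mult_power_neq_1: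
  fixes q x :: "'a :: real_normed_div_algebra"
  assumes "norm q < 1" "norm x < 1"
  shows "x * q ^ k \<noteq> 1"
  using norm_mult_power_le[OF assms(1), of x k] assms(2) by auto

lemma norm_qpoch_fin_le:
  fixes q x :: "'a :: real_normed_field"
  assumes "norm q < 1" "norm x \<le> r"
  shows "norm (qpoch_fin q x n) \<le> exp (r / (1 - norm q))"
proof -
  have "norm (qpoch_fin q x n) \<le> (\<Prod>k<n. 1 + norm (x * q ^ k))"
    unfolding qpoch_fin_def prod_norm[symmetric]
    by (intro prod_mono conjI norm_ge_zero order_trans[OF norm_triangle_ineq4]) simp
  also have "\<dots> \<le> exp (\<Sum>k<n. norm (x * q ^ k))"
    by (rule prod_le_exp_sum) simp
  also have "(\<Sum>k<n. norm (x * q ^ k)) = norm x * (\<Sum>k<n. norm q ^ k)"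
    by (simp add: norm_mult norm_power sum_distrib_left)
  also have "\<dots> \<le> r * (1 / (1 - norm q))"
  proof (rule mult_mono)
    have "(\<Sum>k<n. norm q ^ k) \<le> (\<Sum>k. norm q ^ k)"
      using assms(1) by (intro sum_le_suminf summable_geometric) auto
    then show "(\<Sum>k<n. norm q ^ k) \<le> 1 / (1 - norm q)"
      using assms(1) by (simp add: suminf_geometric)
  qed (use assms in \<open>auto intro: sum_nonneg order_trans[OF norm_ge_zero]\<close>)
  finally show ?thesis by simp
qed

subsection \<open>Basic hypergeometric series\<close>

definition phi10_coeff :: "complex \<Rightarrow> complex \<Rightarrow> nat \<Rightarrow> complex" where
  "phi10_coeff q a n = qpoch_fin q a n / qpoch_fin q q n"

definition phi10 :: "complex \<Rightarrow> complex \<Rightarrow> complex \<Rightarrow> complex" where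
  "phi10 q a z = (\<Sum>n. phi10_coeff q a n * z ^ n)"

definition phi21_term :: "complex \<Rightarrow> complex \<Rightarrow> complex \<Rightarrow> complex \<Rightarrow> complex \<Rightarrow> nat \<Rightarrow> complex" where
  "phi21_term q a b c z n =
    qpoch_fin q a n * qpoch_fin q b n / (qpoch_fin q q n * qpoch_fin q c n) * z ^ n"

definition phi21 :: "complex \<Rightarrow> complex \<Rightarrow> complex \<Rightarrow> complex \<Rightarrow> complex \<Rightarrow> complex" where
  "phi21 q a b c z = (\<Sum>n. phi21_term q a b c z n)"

text \<open>
  The regularised series is \<open>(c)\<^sub>\<infinity> \<^sub>2\<phi>\<^sub>1(a, b; c; z)\<close>: absorbing the factor removes the poles in \<open>c\<close>,
  so that the result is entire in \<open>b\<close> and \<open>c\<close>.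
\<close>
definition reg_phi21_term :: "complex \<Rightarrow> complex \<Rightarrow> complex \<Rightarrow> complex \<Rightarrow> complex \<Rightarrow> nat \<Rightarrow> complex" where
  "reg_phi21_term q a b c z n =
    phi10_coeff q a n * qpoch_fin q b n * qpoch_inf q (c * q ^ n) * z ^ n"

definition reg_phi21 :: "complex \<Rightarrow> complex \<Rightarrow> complex \<Rightarrow> complex \<Rightarrow> complex \<Rightarrow> complex" where
  "reg_phi21 q a b c z = (\<Sum>n. reg_phi21_term q a b c z n)"

definition heine_double_term ::
    "complex \<Rightarrow> complex \<Rightarrow> complex \<Rightarrow> complex \<Rightarrow> complex \<Rightarrow> nat \<Rightarrow> nat \<Rightarrow> complex" where
  "heine_double_term q a z d b n k =
    (phi10_coeff q a n * z ^ n) * (phi10_coeff q d k * b ^ k) * q ^ (n * k)"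

context
  fixes q :: complex
  assumes norm_q: "norm q < 1"
begin

subsection \<open>Infinite \<open>q\<close>-Pochhammer symbols\<close>

lemma qpoch_int_eq_qpoch_fin: "qpoch q x (int n) = qpoch_fin q x n"
  using norm_q by (simp add: qpoch_nonneg qpoch_fin_def)

text \<open>For \<open>a = q\<^sup>k\<close> or \<open>b = q\<^sup>k\<close> with \<open>1 \<le> k \<le> n\<close>, both sides are \<open>0\<close> because \<open>x / 0 = 0\<close>.\<close>
lemma qpoch_divide_qpoch_neg:
  assumes "q \<noteq> 0" "a \<noteq> 0" "b \<noteq> 0"
  shows "qpoch q a (- int n) / qpoch q b (- int n) =
    qpoch_fin q (q / b) n / qpoch_fin q (q / a) n * (b / a) ^ n"
proof -
  have "(\<Prod>k=1..n. - b / q ^ k) / (\<Prod>k=1..n. - a / q ^ k) = (b / a) ^ n"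
    using assms(1) by (simp flip: prod_dividef)
  then show ?thesis
    unfolding qpoch_neg[OF norm_q assms(1)]
      prod_one_minus_divide_power[OF assms(1,2)] prod_one_minus_divide_power[OF assms(1,3)]
    by (simp flip: times_divide_times_eq)
qed

lemma qpoch_fin_mult_qpoch_inf: "qpoch_fin q x n * qpoch_inf q (x * q ^ n) = qpoch_inf q x"
  using qpoch_inf_split[OF norm_q] by (simp add: qpoch_fin_def)

lemma qpoch_fin_tendsto: "qpoch_fin q x \<longlonglongrightarrow> qpoch_inf q x"
  using has_prod_imp_tendsto'[OF convergent_prod_has_prod[OF convergent_prod_qpoch_inf[OF norm_q]]]
  by (simp add: qpoch_fin_def[abs_def] qpoch_inf_def)

lemma qpoch_inf_nonzero:
  assumes "\<And>k. x * q ^ k \<noteq> 1"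
  shows "qpoch_inf q x \<noteq> 0"
  unfolding qpoch_inf_def using assms
  by (intro prodinf_nonzero convergent_prod_qpoch_inf norm_q) auto

lemma norm_qpoch_inf_le: "norm x \<le> r \<Longrightarrow> norm (qpoch_inf q x) \<le> exp (r / (1 - norm q))"
  by (rule tendsto_upperbound[OF tendsto_norm[OF qpoch_fin_tendsto]])
     (auto intro: always_eventually norm_qpoch_fin_le norm_q)

lemma Bseq_qpoch_fin_divide:
  assumes "\<And>k. y * q ^ k \<noteq> 1"
  shows "Bseq (\<lambda>n. qpoch_fin q x n / qpoch_fin q y n)"
  using tendsto_divide[OF qpoch_fin_tendsto qpoch_fin_tendsto qpoch_inf_nonzero[OF assms]]
  by (intro convergent_imp_Bseq convergentI)

lemma uniform_limit_qpoch_fin: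
  assumes "compact A"
  shows "uniform_limit A (\<lambda>n x. qpoch_fin q x n) (qpoch_inf q) sequentially"
proof -
  obtain r where r: "\<And>x. x \<in> A \<Longrightarrow> norm x \<le> r"
    using compact_imp_bounded[OF assms] by (auto simp: bounded_iff)
  have "uniformly_convergent_on A (\<lambda>N x. \<Sum>k<N. norm (1 - x * q ^ k - 1))"
    by (rule Weierstrass_m_test'[where M = "\<lambda>k. r * norm q ^ k"])
       (use norm_q r in \<open>simp_all add: norm_mult norm_power mult_right_mono
          summable_mult summable_geometric\<close>)
  then have "uniformly_convergent_on A (\<lambda>n x. qpoch_fin q x n)"
    unfolding qpoch_fin_def by (intro uniformly_convergent_on_prod' assms continuous_intros)
  then show ?thesis
    by (simp add: uniformly_convergent_uniform_limit_iff limI[OF qpoch_fin_tendsto])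
qed

lemma qpoch_inf_holomorphic [holomorphic_intros]:
  assumes "f holomorphic_on S"
  shows "(\<lambda>w. qpoch_inf q (f w)) holomorphic_on S"
proof -
  have "qpoch_inf q holomorphic_on UNIV"
  proof (rule holomorphic_uniform_sequence)
    show "(\<lambda>x. qpoch_fin q x n) holomorphic_on UNIV" for n
      unfolding qpoch_fin_def by (intro holomorphic_intros)
    show "\<exists>d>0. cball x d \<subseteq> UNIV \<and>
        uniform_limit (cball x d) (\<lambda>n x. qpoch_fin q x n) (qpoch_inf q) sequentially" for x
      by (intro exI[of _ 1]) (auto intro: uniform_limit_qpoch_fin)
  qed simp
  from holomorphic_on_compose_gen[OF assms this] show ?thesis
    by (simp add: o_def)
qed

subsection \<open>The \<open>q\<close>-binomial theorem\<close>

lemma qpoch_fin_q_nonzero: "qpoch_fin q q n \<noteq> 0"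
  by (intro qpoch_fin_nonzero mult_power_neq_1 norm_q)

lemma phi10_coeff_Suc:
  "phi10_coeff q a (Suc n) * (1 - q ^ Suc n) = phi10_coeff q a n * (1 - a * q ^ n)"
  using qpoch_fin_q_nonzero[of "Suc n"] by (simp add: phi10_coeff_def qpoch_fin_Suc)

lemma Bseq_phi10_coeff: "Bseq (phi10_coeff q a)"
  unfolding phi10_coeff_def[abs_def] by (intro Bseq_qpoch_fin_divide mult_power_neq_1 norm_q)

lemma summable_norm_phi10:
  "norm z < 1 \<Longrightarrow> summable (\<lambda>n. norm (phi10_coeff q a n * z ^ n))"
  by (intro summable_norm_Bseq_times_power Bseq_phi10_coeff)

lemma phi10_sums: "norm z < 1 \<Longrightarrow> (\<lambda>n. phi10_coeff q a n * z ^ n) sums phi10 q a z"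
  unfolding phi10_def by (intro summable_sums[OF summable_norm_cancel] summable_norm_phi10)

lemma phi10_functional_equation:
  assumes "norm z < 1"
  shows "(1 - z) * phi10 q a z = (1 - a * z) * phi10 q a (z * q)"
proof -
  let ?c = "phi10_coeff q a"
  have norm_zq: "norm (z * q) < 1"
    using norm_mult_power_le[OF norm_q, of z 1] assms by simp
  have "(\<lambda>n. ?c n * z ^ n - ?c n * (z * q) ^ n) sums (phi10 q a z - phi10 q a (z * q))"
    by (intro sums_diff phi10_sums assms norm_zq)
  then have "(\<lambda>n. ?c (Suc n) * z ^ Suc n - ?c (Suc n) * (z * q) ^ Suc n) sums
      (phi10 q a z - phi10 q a (z * q))"
    by (subst sums_Suc_iff) simp
  moreover have "?c (Suc n) * z ^ Suc n - ?c (Suc n) * (z * q) ^ Suc n =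
      z * (?c n * z ^ n - a * (?c n * (z * q) ^ n))" for n
  proof -
    have "?c (Suc n) * z ^ Suc n - ?c (Suc n) * (z * q) ^ Suc n =
        ?c (Suc n) * (1 - q ^ Suc n) * z ^ Suc n"
      by (simp add: power_mult_distrib algebra_simps)
    also have "\<dots> = z * (?c n * z ^ n - a * (?c n * (z * q) ^ n))"
      unfolding phi10_coeff_Suc by (simp add: power_mult_distrib algebra_simps)
    finally show ?thesis .
  qed
  moreover have "(\<lambda>n. z * (?c n * z ^ n - a * (?c n * (z * q) ^ n))) sums
      (z * (phi10 q a z - a * phi10 q a (z * q)))"
    by (intro sums_mult sums_diff phi10_sums assms norm_zq)
  ultimately have "phi10 q a z - phi10 q a (z * q) = z * (phi10 q a z - a * phi10 q a (z * q))"
    by (simp add: sums_unique2)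
  then show ?thesis
    by (simp add: algebra_simps)
qed

lemma qpoch_fin_mult_phi10:
  assumes "norm z < 1"
  shows "qpoch_fin q z m * phi10 q a z = qpoch_fin q (a * z) m * phi10 q a (z * q ^ m)"
proof (induction m)
  case (Suc m)
  have "norm (z * q ^ m) < 1"
    using norm_mult_power_le[OF norm_q, of z m] assms by simp
  then have step: "(1 - z * q ^ m) * phi10 q a (z * q ^ m) =
      (1 - a * z * q ^ m) * phi10 q a (z * q ^ Suc m)"
    using phi10_functional_equation[of "z * q ^ m" a] by (simp add: mult_ac)
  have "qpoch_fin q z (Suc m) * phi10 q a z = (1 - z * q ^ m) * (qpoch_fin q z m * phi10 q a z)"
    by (simp add: qpoch_fin_Suc)
  also have "\<dots> = qpoch_fin q (a * z) m * ((1 - z * q ^ m) * phi10 q a (z * q ^ m))"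
    unfolding Suc by (simp only: mult_ac)
  also have "\<dots> = qpoch_fin q (a * z) (Suc m) * phi10 q a (z * q ^ Suc m)"
    unfolding step by (simp add: qpoch_fin_Suc)
  finally show ?case .
qed simp

lemma q_binomial:
  assumes "norm z < 1"
  shows "phi10 q a z = qpoch_inf q (a * z) / qpoch_inf q z"
proof -
  have "isCont (phi10 q a) 0"
    unfolding phi10_def[abs_def]
    by (rule isCont_powser[OF summable_norm_cancel[OF summable_norm_phi10[of "1 / 2"]]]) simp_all
  moreover have "(\<lambda>m. z * q ^ m) \<longlonglongrightarrow> 0"
    by (rule tendsto_mult_right_zero[OF LIMSEQ_power_zero[OF norm_q]])
  ultimately have "(\<lambda>m. phi10 q a (z * q ^ m)) \<longlonglongrightarrow> phi10 q a 0"
    by (rule isCont_tendsto_compose)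
  then have "(\<lambda>m. qpoch_fin q z m * phi10 q a z) \<longlonglongrightarrow> qpoch_inf q (a * z) * phi10 q a 0"
    unfolding qpoch_fin_mult_phi10[OF assms] by (intro tendsto_mult qpoch_fin_tendsto)
  moreover have "phi10 q a 0 = 1"
    unfolding phi10_def powser_zero by (simp add: phi10_coeff_def)
  ultimately have "qpoch_inf q z * phi10 q a z = qpoch_inf q (a * z)"
    using LIMSEQ_unique[OF tendsto_mult_right[OF qpoch_fin_tendsto]] by simp
  moreover have "qpoch_inf q z \<noteq> 0"
    by (intro qpoch_inf_nonzero mult_power_neq_1 norm_q assms)
  ultimately show ?thesis
    by (simp add: field_simps)
qed

subsection \<open>Heine's transformations\<close>

lemma reg_phi21_commute: "reg_phi21 q a b c z = reg_phi21 q b a c z"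
  by (simp add: reg_phi21_def reg_phi21_term_def phi10_coeff_def mult_ac)

lemma norm_reg_phi21_term_le:
  obtains M where
    "\<And>b c n. norm b \<le> r \<Longrightarrow> norm c \<le> r \<Longrightarrow> norm (reg_phi21_term q a b c z n) \<le> M * norm z ^ n"
proof -
  define E where "E = exp (r / (1 - norm q))"
  obtain K where K: "\<And>n. norm (phi10_coeff q a n) \<le> K"
    using Bseq_phi10_coeff by (metis BseqE)
  have "norm (reg_phi21_term q a b c z n) \<le> K * E * E * norm z ^ n"
    if "norm b \<le> r" "norm c \<le> r" for b c n
  proof -
    have "norm (qpoch_fin q b n) \<le> E"
      unfolding E_def by (intro norm_qpoch_fin_le norm_q that)
    moreover have "norm (qpoch_inf q (c * q ^ n)) \<le> E"
      unfolding E_def by (intro norm_qpoch_inf_le order_trans[OF norm_mult_power_le[OF norm_q]] that)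
    moreover have "0 \<le> K"
      using K[of 0] norm_ge_zero order_trans by blast
    ultimately show ?thesis
      unfolding reg_phi21_term_def norm_mult norm_power
      by (intro mult_mono K) (auto simp: E_def)
  qed
  then show ?thesis
    by (rule that)
qed

lemma summable_norm_reg_phi21_term:
  assumes "norm z < 1"
  shows "summable (\<lambda>n. norm (reg_phi21_term q a b c z n))"
proof -
  define r where "r = max (norm b) (norm c)"
  obtain M where "\<And>b c n. norm b \<le> r \<Longrightarrow> norm c \<le> r \<Longrightarrow>
      norm (reg_phi21_term q a b c z n) \<le> M * norm z ^ n"
    using norm_reg_phi21_term_le[of r a z] by blast
  then have M: "norm (reg_phi21_term q a b c z n) \<le> M * norm z ^ n" for n
    by (simp add: r_def)
  have "summable (\<lambda>n. M * norm z ^ n)"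
    using assms by (intro summable_mult summable_geometric) simp
  then show ?thesis
    by (rule summable_comparison_test') (simp add: M)
qed

lemma reg_phi21_holomorphic [holomorphic_intros]:
  assumes "open S" "f holomorphic_on S" "g holomorphic_on S" "norm z < 1"
  shows "(\<lambda>w. reg_phi21 q a (f w) (g w) z) holomorphic_on S"
proof (rule holomorphic_uniform_sequence[OF assms(1)])
  show "(\<lambda>w. \<Sum>n<N. reg_phi21_term q a (f w) (g w) z n) holomorphic_on S" for N
    unfolding reg_phi21_term_def qpoch_fin_def by (intro holomorphic_intros assms)
next
  fix x assume "x \<in> S"
  then obtain d where d: "d > 0" "cball x d \<subseteq> S"
    using assms(1) open_contains_cball by blast
  have "continuous_on (cball x d) (\<lambda>w. (f w, g w))"
    by (intro continuous_on_Pair holomorphic_on_imp_continuous_on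
        holomorphic_on_subset[OF _ d(2)] assms)
  then have "bounded ((\<lambda>w. (f w, g w)) ` cball x d)"
    by (intro compact_imp_bounded compact_continuous_image) auto
  then obtain r where r: "\<forall>w\<in>cball x d. norm (f w, g w) \<le> r"
    by (auto simp: bounded_iff)
  obtain M where M: "\<And>b c n. norm b \<le> r \<Longrightarrow> norm c \<le> r \<Longrightarrow>
      norm (reg_phi21_term q a b c z n) \<le> M * norm z ^ n"
    using norm_reg_phi21_term_le[of r a z] by blast
  have "uniform_limit (cball x d) (\<lambda>N w. \<Sum>n<N. reg_phi21_term q a (f w) (g w) z n)
      (\<lambda>w. reg_phi21 q a (f w) (g w) z) sequentially"
    unfolding reg_phi21_def
  proof (rule Weierstrass_m_test)
    show "norm (reg_phi21_term q a (f w) (g w) z n) \<le> M * norm z ^ n" if "w \<in> cball x d" for n w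
      using bspec[OF r that] norm_fst_le[of "f w" "g w"] norm_snd_le[of "g w" "f w"]
      by (intro M) auto
    show "summable (\<lambda>n. M * norm z ^ n)"
      using assms(4) by (intro summable_mult summable_geometric) simp
  qed
  with d show "\<exists>d>0. cball x d \<subseteq> S \<and>
      uniform_limit (cball x d) (\<lambda>N w. \<Sum>n<N. reg_phi21_term q a (f w) (g w) z n)
        (\<lambda>w. reg_phi21 q a (f w) (g w) z) sequentially"
    by blast
qed

lemma heine_double_term_swap: "heine_double_term q a z d b n k = heine_double_term q d b a z k n"
  by (simp add: heine_double_term_def mult_ac)

lemma norm_heine_double_term_le:
  "norm (heine_double_term q a z d b n k) \<le>
    norm (phi10_coeff q a n * z ^ n) * norm (phi10_coeff q d k * b ^ k)"
  unfolding heine_double_term_def norm_mult[symmetric] by (rule norm_mult_power_le[OF norm_q])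

lemma suminf_heine_double_term:
  assumes "norm b < 1"
  shows "(\<Sum>k. heine_double_term q a z d b n k) = reg_phi21_term q a b (d * b) z n / qpoch_inf q b"
proof -
  have norm_bq: "norm (b * q ^ n) < 1"
    using norm_mult_power_le[OF norm_q, of b n] assms by simp
  have "(\<Sum>k. heine_double_term q a z d b n k) =
      (\<Sum>k. (phi10_coeff q a n * z ^ n) * (phi10_coeff q d k * (b * q ^ n) ^ k))"
    by (simp add: heine_double_term_def power_mult_distrib mult.assoc flip: power_mult)
  also have "\<dots> = (phi10_coeff q a n * z ^ n) * phi10 q d (b * q ^ n)"
    unfolding phi10_def by (intro suminf_mult sums_summable[OF phi10_sums[OF norm_bq]])
  also have "phi10 q d (b * q ^ n) = qpoch_inf q (d * b * q ^ n) / qpoch_inf q (b * q ^ n)"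
    using q_binomial[OF norm_bq, of d] by (simp add: mult.assoc)
  also have "\<dots> = qpoch_fin q b n * qpoch_inf q (d * b * q ^ n) / qpoch_inf q b"
    using qpoch_fin_nonzero[OF mult_power_neq_1[OF norm_q assms]]
    unfolding qpoch_fin_mult_qpoch_inf[of b n, symmetric] by simp
  finally show ?thesis
    by (simp add: reg_phi21_term_def)
qed

lemma suminf_suminf_heine_double_term:
  assumes "norm z < 1" "norm b < 1"
  shows "(\<Sum>n. \<Sum>k. heine_double_term q a z d b n k) = reg_phi21 q a b (d * b) z / qpoch_inf q b"
  unfolding suminf_heine_double_term[OF assms(2)] reg_phi21_def
  by (intro suminf_divide summable_norm_cancel[OF summable_norm_reg_phi21_term] assms)

lemma reg_heine_transformation_1:
  assumes "norm z < 1" "norm b < 1"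
  shows "qpoch_inf q z * reg_phi21 q a b (d * b) z = qpoch_inf q b * reg_phi21 q d z (a * z) b"
proof -
  have "(\<Sum>n. \<Sum>k. heine_double_term q a z d b n k) = (\<Sum>k. \<Sum>n. heine_double_term q a z d b n k)"
    by (intro suminf_swap_dominated[OF _ _ _ _ norm_heine_double_term_le] summable_norm_phi10
        assms norm_ge_zero)
  also have "\<dots> = (\<Sum>k. \<Sum>n. heine_double_term q d b a z k n)"
    by (simp only: heine_double_term_swap)
  finally have "reg_phi21 q a b (d * b) z / qpoch_inf q b =
      reg_phi21 q d z (a * z) b / qpoch_inf q z"
    using assms by (simp only: suminf_suminf_heine_double_term)
  moreover have "qpoch_inf q b \<noteq> 0" "qpoch_inf q z \<noteq> 0"
    by (intro qpoch_inf_nonzero mult_power_neq_1 norm_q assms)+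
  ultimately show ?thesis
    by (simp add: field_simps)
qed

lemma reg_heine_transformation_2:
  assumes "norm z < 1" "norm d < 1" "d \<noteq> 0"
  shows "qpoch_inf q z * reg_phi21 q a b (d * b) z =
    qpoch_inf q d * reg_phi21 q (a * z / d) b (z * b) d"
proof (rule analytic_continuation_open[where s = "ball 0 1" and s' = UNIV and z = b
      and f = "\<lambda>w. qpoch_inf q z * reg_phi21 q a w (d * w) z"
      and g = "\<lambda>w. qpoch_inf q d * reg_phi21 q (a * z / d) w (z * w) d"])
  show "qpoch_inf q z * reg_phi21 q a w (d * w) z =
      qpoch_inf q d * reg_phi21 q (a * z / d) w (z * w) d"
    if "w \<in> ball 0 1" for w
  proof -
    have norm_w: "norm w < 1"
      using that by simp
    have "qpoch_inf q z * reg_phi21 q a w (d * w) z = qpoch_inf q w * reg_phi21 q d z (a * z) w"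
      by (rule reg_heine_transformation_1[OF assms(1) norm_w])
    also have "\<dots> = qpoch_inf q w * reg_phi21 q z d (a * z / d * d) w"
      using assms(3) by (simp add: reg_phi21_commute)
    also have "\<dots> = qpoch_inf q d * reg_phi21 q (a * z / d) w (z * w) d"
      by (rule reg_heine_transformation_1[OF norm_w assms(2)])
    finally show ?thesis .
  qed
qed (auto intro!: holomorphic_intros assms)

lemma reg_phi21_term_eq:
  assumes "\<And>k. c * q ^ k \<noteq> 1"
  shows "reg_phi21_term q a b c z n = qpoch_inf q c * phi21_term q a b c z n"
  unfolding qpoch_fin_mult_qpoch_inf[of c n, symmetric]
    reg_phi21_term_def phi21_term_def phi10_coeff_def
  using qpoch_fin_nonzero[OF assms, of n] by simp

lemma summable_norm_phi21_term:
  assumes "\<And>k. c * q ^ k \<noteq> 1" "norm z < 1"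
  shows "summable (\<lambda>n. norm (phi21_term q a b c z n))"
  using summable_norm_reg_phi21_term[OF assms(2), of a b c] qpoch_inf_nonzero[OF assms(1)]
  by (simp add: reg_phi21_term_eq[OF assms(1)] norm_mult summable_cmult_iff)

lemma reg_phi21_eq:
  assumes "\<And>k. c * q ^ k \<noteq> 1" "norm z < 1"
  shows "reg_phi21 q a b c z = qpoch_inf q c * phi21 q a b c z"
  unfolding reg_phi21_def phi21_def reg_phi21_term_eq[OF assms(1)]
  by (intro suminf_mult[OF summable_norm_cancel] summable_norm_phi21_term assms)

theorem heine_transformation_1:
  assumes "norm z < 1" "norm b < 1" "b \<noteq> 0"
    and "\<And>k. c * q ^ k \<noteq> 1" "\<And>k. a * z * q ^ k \<noteq> 1"
  shows "phi21 q a b c z = qpoch_inf q b * qpoch_inf q (a * z) / (qpoch_inf q c * qpoch_inf q z)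
    * phi21 q (c / b) z (a * z) b"
proof -
  have "qpoch_inf q z * (qpoch_inf q c * phi21 q a b c z) =
      qpoch_inf q b * (qpoch_inf q (a * z) * phi21 q (c / b) z (a * z) b)"
    using reg_heine_transformation_1[OF assms(1,2), of a "c / b"] assms by (simp add: reg_phi21_eq)
  moreover have "qpoch_inf q z \<noteq> 0" "qpoch_inf q c \<noteq> 0"
    by (intro qpoch_inf_nonzero mult_power_neq_1 norm_q assms)+
  ultimately show ?thesis
    by (simp add: field_simps)
qed

theorem heine_transformation_2:
  assumes "norm z < 1" "norm (c / b) < 1" "b \<noteq> 0" "c \<noteq> 0"
    and "\<And>k. c * q ^ k \<noteq> 1" "\<And>k. b * z * q ^ k \<noteq> 1"
  shows "phi21 q a b c z = qpoch_inf q (c / b) * qpoch_inf q (b * z) / (qpoch_inf q c * qpoch_inf q z)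
    * phi21 q (a * b * z / c) b (b * z) (c / b)"
proof -
  have "qpoch_inf q z * (qpoch_inf q c * phi21 q a b c z) =
      qpoch_inf q (c / b) * (qpoch_inf q (b * z) * phi21 q (a * b * z / c) b (b * z) (c / b))"
    using reg_heine_transformation_2[OF assms(1,2), of a b] assms
    by (simp add: reg_phi21_eq mult_ac)
  moreover have "qpoch_inf q z \<noteq> 0" "qpoch_inf q c \<noteq> 0"
    by (intro qpoch_inf_nonzero mult_power_neq_1 norm_q assms)+
  ultimately show ?thesis
    by (simp add: field_simps)
qed

subsection \<open>The bilateral series\<close>

lemma bilateral_series_has_sum:
  assumes "q \<noteq> 0" "a \<noteq> 0" "b \<noteq> 0" "norm z < 1" "norm (b / (a * z)) < 1"
    and "\<And>k. b * q ^ k \<noteq> 1" "\<And>k. q / a * q ^ k \<noteq> 1"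
  shows "((\<lambda>n. qpoch q a n / qpoch q b n * z powi n) has_sum
    (phi21 q q a b z + phi21 q q (q / b) (q / a) (b / (a * z)) - 1)) UNIV"
proof -
  define f where "f n = qpoch q a n / qpoch q b n * z powi n" for n
  have nonneg: "f (int n) = phi21_term q q a b z n" for n
    by (simp add: f_def phi21_term_def qpoch_int_eq_qpoch_fin qpoch_fin_q_nonzero)
  have neg: "f (- int n) = phi21_term q q (q / b) (q / a) (b / (a * z)) n" for n
    unfolding f_def qpoch_divide_qpoch_neg[OF assms(1-3)]
    by (simp add: phi21_term_def qpoch_fin_q_nonzero power_int_minus power_divide
        power_mult_distrib divide_simps)
  have "(f has_sum ((\<Sum>n. f (int n)) + (\<Sum>n. f (- int n)) - f 0)) UNIV"
    by (rule has_sum_int_halves; unfold nonneg neg; intro summable_norm_phi21_term assms)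
  moreover have "f 0 = 1"
    using nonneg[of 0] by (simp add: phi21_term_def)
  ultimately show ?thesis
    unfolding nonneg neg unfolding phi21_def f_def by simp
qed

lemma bilateral_series_transformation:
  assumes "q \<noteq> 0" "a \<noteq> 0" "b \<noteq> 0" "norm (b / a) < norm z" "norm z < 1" "norm a < 1"
    and qa_neq_1: "\<And>k. q / a * q ^ k \<noteq> 1" and qaz_neq_1: "\<And>k. q / (a * z) * q ^ k \<noteq> 1"
  shows "((\<lambda>n. qpoch q a n / qpoch q b n * z powi n) has_sum
    (- 1
      + qpoch_inf q a * qpoch_inf q (q * z) / (qpoch_inf q b * qpoch_inf q z)
        * phi21 q (b / a) z (q * z) a
      + qpoch_inf q (b / a) * qpoch_inf q (q / (a * z))
          / (qpoch_inf q (q / a) * qpoch_inf q (b / (a * z)))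
        * phi21 q (q / z) (q / b) (q / (a * z)) (b / a))) UNIV"
proof -
  have norm_ba: "norm (b / a) < 1"
    using assms(4,5) by linarith
  have norm_baz: "norm (b / (a * z)) < 1"
  proof -
    have "norm (b / (a * z)) = norm (b / a) / norm z"
      by (simp add: norm_divide norm_mult)
    also have "\<dots> < 1"
      using assms(4) norm_ge_zero[of "b / a"] by (subst divide_less_eq_1_pos) linarith+
    finally show ?thesis .
  qed
  have "norm b < 1"
    using mult_strict_mono[OF norm_ba assms(6)] assms(2) by (simp add: norm_divide)
  then have b_neq_1: "b * q ^ k \<noteq> 1" for k
    by (rule mult_power_neq_1[OF norm_q])
  have qz_neq_1: "q * z * q ^ k \<noteq> 1" for k
    using mult_power_neq_1[OF norm_q assms(5), of "Suc k"] by (simp add: mult_ac)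
  have nonneg: "phi21 q q a b z =
      qpoch_inf q a * qpoch_inf q (q * z) / (qpoch_inf q b * qpoch_inf q z)
      * phi21 q (b / a) z (q * z) a"
    by (rule heine_transformation_1[OF assms(5,6,2) b_neq_1 qz_neq_1])
  have params: "q / a / (q / b) = b / a" "q / b * (b / (a * z)) = q / (a * z)"
      "q * (q / b) * (b / (a * z)) / (q / a) = q / z"
    using assms(1-3) by simp_all
  have neg: "phi21 q q (q / b) (q / a) (b / (a * z)) =
      qpoch_inf q (b / a) * qpoch_inf q (q / (a * z))
        / (qpoch_inf q (q / a) * qpoch_inf q (b / (a * z)))
      * phi21 q (q / z) (q / b) (q / (a * z)) (b / a)"
    using heine_transformation_2[OF norm_baz, of "q / a" "q / b" q] norm_ba assms(1-3)
      qa_neq_1 qaz_neq_1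
    unfolding params by simp
  show ?thesis
    using bilateral_series_has_sum[OF assms(1-3,5) norm_baz b_neq_1 qa_neq_1] unfolding nonneg neg
    by (simp add: algebra_simps)
qed

end

theorem theorem2p2:
  fixes q a b z :: complex
  assumes "norm q < 1"
    and "norm (b / a) < norm z" and "norm z < 1"
    and "norm a < 1"
    and "q \<noteq> 0" and "a \<noteq> 0" and "b \<noteq> 0"
    and "\<forall>k::nat. k \<ge> 1 \<longrightarrow> a \<noteq> q ^ k"
    and "\<forall>k::nat. k \<ge> 1 \<longrightarrow> a * z \<noteq> q ^ k"
  shows "(\<lambda>n::int. qpoch q a n / qpoch q b n * z powi n) summable_on UNIV
    \<and> summable (\<lambda>n::nat. qpoch q (b / a) (int n) * qpoch q z (int n)
          / (qpoch q q (int n) * qpoch q (q * z) (int n)) * a ^ n)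
    \<and> summable (\<lambda>n::nat. qpoch q (q / z) (int n) * qpoch q (q / b) (int n)
          / (qpoch q q (int n) * qpoch q (q / (a * z)) (int n)) * (b / a) ^ n)
    \<and> (\<Sum>\<^sub>\<infinity>n::int. qpoch q a n / qpoch q b n * z powi n) =
      - 1
      + qpoch_inf q a * qpoch_inf q (q * z) / (qpoch_inf q b * qpoch_inf q z)
        * (\<Sum>n::nat. qpoch q (b / a) (int n) * qpoch q z (int n)
            / (qpoch q q (int n) * qpoch q (q * z) (int n)) * a ^ n)
      + qpoch_inf q (b / a) * qpoch_inf q (q / (a * z))
          / (qpoch_inf q (q / a) * qpoch_inf q (b / (a * z)))
        * (\<Sum>n::nat. qpoch q (q / z) (int n) * qpoch q (q / b) (int n)
            / (qpoch q q (int n) * qpoch q (q / (a * z)) (int n)) * (b / a) ^ n)"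
proof -
  have z_nonzero: "z \<noteq> 0"
    using assms(2) by auto
  have norm_ba: "norm (b / a) < 1"
    using assms(2,3) by linarith
  have qz_neq_1: "q * z * q ^ k \<noteq> 1" for k
    using mult_power_neq_1[OF assms(1,3), of "Suc k"] by (simp add: mult_ac)
  have qa_neq_1: "q / a * q ^ k \<noteq> 1" for k
    by (rule q_divide_mult_power_neq_1[OF assms(6,8)])
  have qaz_neq_1: "q / (a * z) * q ^ k \<noteq> 1" for k
    using assms(6,9) z_nonzero by (intro q_divide_mult_power_neq_1) simp_all
  note bilateral = bilateral_series_transformation[OF assms(1,5-7,2-4) qa_neq_1 qaz_neq_1]
  have "summable (phi21_term q (b / a) z (q * z) a)"
    by (rule summable_norm_cancel[OF summable_norm_phi21_term[OF assms(1) qz_neq_1 assms(4)]])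
  moreover have "summable (phi21_term q (q / z) (q / b) (q / (a * z)) (b / a))"
    by (rule summable_norm_cancel[OF summable_norm_phi21_term[OF assms(1) qaz_neq_1 norm_ba]])
  ultimately show ?thesis
    using infsumI[OF bilateral] has_sum_imp_summable[OF bilateral]
    by (simp only: qpoch_int_eq_qpoch_fin[OF assms(1)] phi21_def phi21_term_def[abs_def])
qed

end
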